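(* Let $(X_t)_{t\in\mathbb N}$ be i.i.d. random vectors in $\mathbb R^2$ with $\mathbb E|X_1|^{2+\gamma}<\infty$ for some $\gamma>0$. Let $\delta>0$ and let $w(U)=(\log(e+|U|))^{-1/2-\delta}$ for $U\in\mathbb R$. Then $$\sup_{n\ge1}\mathbb E\|C_n\|_{L_\infty(w)}<\infty .$$
   Context: $\mathcal A=\{\mathbf u\in\mathbb R^2:\mathbf u=(U,U),\,U\in\mathbb R\}$. The normalized empirical characteristic function process is $C_n(\mathbf u)=\frac1{\sqrt n}\sum_{t=1}^n\big(e^{i\langle\mathbf u,X_t\rangle}-\mathbb E[e^{i\langle\mathbf u,X_1\rangle}]\big)$, and $\mathbb E\|C_n\|_{L_\infty(w)}:=\mathbb E\sup_{\mathbf u=(U,U)\in\mathcal A}\{|C_n(\mathbf u)|\,w(U)\}$. *)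

theory Defs
  imports "HOL-Probability.Probability"
begin

definition diagonal :: "(real ^ 2) set" where
  "diagonal = {u. \<exists>U::real. u = vector [U, U]}"

definition log_weight :: "real \<Rightarrow> real \<Rightarrow> real" where
  "log_weight \<delta> U = ln (exp 1 + \<bar>U\<bar>) powr (- 1 / 2 - \<delta>)"

definition ecf_process ::
  "'w measure \<Rightarrow> (nat \<Rightarrow> 'w \<Rightarrow> real ^ 2) \<Rightarrow> nat \<Rightarrow> real ^ 2 \<Rightarrow> 'w \<Rightarrow> complex" where
  "ecf_process M X n u \<omega> =
     complex_of_real (1 / sqrt (real n)) *
       (\<Sum>t = 1..n. iexp (u \<bullet> X t \<omega>) - (\<integral>\<omega>'. iexp (u \<bullet> X 1 \<omega>') \<partial>M))"

(* The supremum over the diagonal is taken in ennreal, so that it is a genuine supremum also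
   for unbounded f. For u = (U, U) the component u $ 1 is U. *)
definition weighted_sup_norm :: "(real \<Rightarrow> real) \<Rightarrow> (real ^ 2 \<Rightarrow> complex) \<Rightarrow> ennreal" where
  "weighted_sup_norm w f = (SUP u\<in>diagonal. ennreal (cmod (f u) * w (u $ 1)))"

end

theory Submission
  imports Defs
begin

text \<open>
  On the diagonal the process only involves the scalars \<open>Y t = X t $ 1 + X t $ 2\<close>.
  If centred independent vectors are added up one at a time, \<open>ln (\<Sum>i. exp (S i))\<close> increases by a term
  linear in the new vector, with coefficients depending only on the past, plus at most four times the
  square of its maximum norm. The linear term has mean zero, so for every finite class with a square
  integrable envelope of norm \<open>b\<close> the normalised sums satisfy a maximal inequality of order
  \<open>b * sqrt (ln N)\<close>, without symmetrisation or exponential moments.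

  Since \<open>\<bar>exp (i v y) - exp (i u y)\<bar> \<le> \<bar>v - u\<bar> * \<bar>y\<bar>\<close>, chaining along dyadic rationals costs
  \<open>2 ^ (- k) * sqrt (m + k)\<close> at level \<open>k\<close> on \<open>\<bar>U\<bar> \<le> 2 ^ m\<close>, which adds up to \<open>O(sqrt m)\<close> uniformly in \<open>n\<close>.
  On the blocks \<open>m = 2 ^ j\<close> the weight is of order \<open>m powr (- 1 / 2 - \<delta>)\<close>, leaving a geometric
  series with ratio \<open>2 powr (- \<delta>)\<close>.
\<close>

subsection \<open>A maximal inequality for finite classes\<close>

text \<open>On [-1, 1] the bound exp x <= 1 + x + x^2 suffices; outside, x + x^2 >= 0 or x <= x^2
  does. Averaging under weights that centre x removes the linear term and leaves exp (x^2) alone,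
  for x of any size.\<close>

lemma exp_le_add_exp_square: "exp x \<le> x + exp (x\<^sup>2)" for x :: real
proof -
  have sq: "1 + x\<^sup>2 \<le> exp (x\<^sup>2)"
    by (rule exp_ge_add_one_self)
  consider "1 \<le> x" | "0 \<le> x" "x \<le> 1" | "-1 \<le> x" "x \<le> 0" | "x \<le> -1"
    by linarith
  then show ?thesis
  proof cases
    case 1
    then have "x \<le> x\<^sup>2"
      by (simp add: self_le_power)
    then have "exp x \<le> exp (x\<^sup>2)"
      by simp
    then show ?thesis
      using 1 by linarith
  next
    case 2
    then show ?thesis
      using exp_bound[of x] sq by linarith
  next
    case 3
    define y where "y = -x"
    have y: "0 \<le> y" "y \<le> 1"
      using 3 by (auto simp: y_def)
    \<comment> \<open>In terms of y = -x the claim exp x <= 1 + x + x^2 reads 1 <= exp y * (1 - y +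
      y^2). Expanding with the quadratic Taylor bound leaves 1 plus nonnegative terms.\<close>
    have "exp y * (1 - y + y\<^sup>2) \<ge> (1 + y + y\<^sup>2 / 2) * (1 - y + y\<^sup>2)"
      using exp_lower_Taylor_quadratic[OF y(1)] y by (intro mult_right_mono) auto
    also have "(1 + y + y\<^sup>2 / 2) * (1 - y + y\<^sup>2) = 1 + y\<^sup>2 / 2 + y ^ 3 / 2 + y ^ 4 / 2"
      by (simp add: field_simps power2_eq_square power3_eq_cube power4_eq_xxxx)
    finally have "1 \<le> exp y * (1 - y + y\<^sup>2)"
      using y by (smt (verit) divide_nonneg_nonneg zero_le_power)
    then have "exp x \<le> 1 + x + x\<^sup>2"
      by (simp add: y_def exp_minus field_simps)
    then show ?thesis
      using sq by linarith
  next
    case 4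
    then have "0 \<le> x * (x + 1)"
      by (intro mult_nonpos_nonpos) auto
    then have "0 \<le> x + x\<^sup>2"
      by (simp add: algebra_simps power2_eq_square)
    moreover have "exp x \<le> 1"
      using 4 by simp
    ultimately show ?thesis
      using sq by linarith
  qed
qed

text \<open>The normalised exponentials are probability weights on \<open>I\<close>. Subtracting the
  mean m of \<open>y\<close> under them makes the linear term of
  \<open>exp_le_add_exp_square\<close> vanish; as |m| <= B, the deviations are at most 2B, whence 4
  * B^2.\<close>

lemma ln_sum_exp_add_le:
  fixes x y :: "'i \<Rightarrow> real"
  assumes "finite I" "I \<noteq> {}" and bound: "\<And>i. i \<in> I \<Longrightarrow> \<bar>y i\<bar> \<le> B"
  shows "ln (\<Sum>i\<in>I. exp (x i + y i)) \<le>
           ln (\<Sum>i\<in>I. exp (x i)) + (\<Sum>i\<in>I. exp (x i) / (\<Sum>j\<in>I. exp (x j)) * y i) + 4 * B\<^sup>2"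
proof -
  define W where "W = (\<Sum>j\<in>I. exp (x j))"
  define p where "p i = exp (x i) / W" for i
  define m where "m = (\<Sum>i\<in>I. p i * y i)"
  have W: "0 < W"
    unfolding W_def using assms by (intro sum_pos) auto
  have p: "0 \<le> p i" for i
    using W by (simp add: p_def)
  have p1: "(\<Sum>i\<in>I. p i) = 1"
    using W by (simp add: p_def sum_divide_distrib [symmetric] W_def)
  have "\<bar>m\<bar> \<le> (\<Sum>i\<in>I. p i * B)"
    unfolding m_def using p bound
    by (intro order.trans[OF sum_abs] sum_mono) (auto simp: abs_mult intro: mult_left_mono)
  also have "\<dots> = B"
    using p1 by (simp add: sum_distrib_right [symmetric])
  finally have m: "\<bar>m\<bar> \<le> B" .
  have "(\<Sum>i\<in>I. p i * exp (y i - m)) \<le> (\<Sum>i\<in>I. p i * ((y i - m) + exp (4 * B\<^sup>2)))"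
  proof (intro sum_mono mult_left_mono p)
    fix i assume "i \<in> I"
    then have "\<bar>y i - m\<bar> \<le> 2 * B"
      using bound[of i] m by linarith
    then have "(y i - m)\<^sup>2 \<le> (2 * B)\<^sup>2"
      by (intro abs_le_square_iff[THEN iffD1]) linarith
    then have "exp ((y i - m)\<^sup>2) \<le> exp (4 * B\<^sup>2)"
      by (simp add: power_mult_distrib)
    then show "exp (y i - m) \<le> y i - m + exp (4 * B\<^sup>2)"
      using exp_le_add_exp_square[of "y i - m"] by linarith
  qed
  also have "\<dots> = exp (4 * B\<^sup>2)"
    using p1 by (simp add: algebra_simps sum.distrib sum_subtractf sum_distrib_left [symmetric]
        sum_distrib_right [symmetric] flip: m_def)
  finally have le: "(\<Sum>i\<in>I. p i * exp (y i - m)) \<le> exp (4 * B\<^sup>2)" .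
  have "(\<Sum>i\<in>I. exp (x i + y i)) = W * exp m * (\<Sum>i\<in>I. p i * exp (y i - m))"
    unfolding sum_distrib_left using W
    by (intro sum.cong refl) (simp add: p_def exp_add exp_diff)
  also have "\<dots> \<le> W * exp m * exp (4 * B\<^sup>2)"
    using W le by (intro mult_left_mono) auto
  finally have "ln (\<Sum>i\<in>I. exp (x i + y i)) \<le> ln (W * exp m * exp (4 * B\<^sup>2))"
    using assms by (intro ln_mono) (auto intro: sum_pos)
  also have "\<dots> = ln W + m + 4 * B\<^sup>2"
    using W by (simp add: ln_mult)
  finally show ?thesis
    by (simp add: W_def m_def p_def)
qed

text \<open>Supplies the integrable majorant for the log-sum-exp: although exponentials of the sums
  may have no expectation, their logarithm grows only linearly in the envelope.\<close>

lemma abs_ln_sum_exp_le: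
  fixes s :: "'i \<Rightarrow> real"
  assumes "finite I" "I \<noteq> {}" "\<And>i. i \<in> I \<Longrightarrow> \<bar>s i\<bar> \<le> B"
  shows "\<bar>ln (\<Sum>i\<in>I. exp (s i))\<bar> \<le> ln (card I) + B"
proof -
  obtain k where k: "k \<in> I"
    using assms by auto
  have "exp (s k) \<le> (\<Sum>i\<in>I. exp (s i))"
    using assms k by (intro member_le_sum) auto
  then have "ln (exp (s k)) \<le> ln (\<Sum>i\<in>I. exp (s i))"
    by (intro ln_mono) (auto intro: less_le_trans[OF exp_gt_zero])
  moreover have "ln (\<Sum>i\<in>I. exp (s i)) \<le> ln (\<Sum>i\<in>I. exp B)"
    using assms by (intro ln_mono sum_mono sum_pos) (auto simp: abs_le_iff)
  moreover have "ln (\<Sum>i\<in>I. exp B) = ln (card I) + B"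
    using assms by (simp add: ln_mult card_gt_0_iff)
  moreover have "0 \<le> ln (card I)"
    using assms by (simp add: Suc_leI card_gt_0_iff)
  ultimately show ?thesis
    using assms(3)[OF k] by auto
qed

text \<open>Induction on the number of summands with \<open>ln_sum_exp_add_le\<close>: the weights
  depend on the past only, hence are independent of the new centred summand, and the linear term has
  expectation zero. The empty sum contributes ln (card I).\<close>

lemma (in prob_space) expectation_ln_sum_exp_le:
  fixes f :: "'i \<Rightarrow> 'b \<Rightarrow> real" and F :: "'b \<Rightarrow> real" and Y :: "nat \<Rightarrow> 'a \<Rightarrow> 'b"
  assumes fin: "finite I" "I \<noteq> {}"
    and indep: "indep_vars (\<lambda>_. N) Y {1..n}"
    and f [measurable]: "\<And>i. i \<in> I \<Longrightarrow> f i \<in> borel_measurable N"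
    and F [measurable]: "F \<in> borel_measurable N"
    and bound: "\<And>i y. i \<in> I \<Longrightarrow> \<bar>f i y\<bar> \<le> F y"
    and F2: "\<And>t. t \<in> {1..n} \<Longrightarrow> integrable M (\<lambda>\<omega>. (F (Y t \<omega>))\<^sup>2)"
    and centred: "\<And>i t. i \<in> I \<Longrightarrow> t \<in> {1..n} \<Longrightarrow> expectation (\<lambda>\<omega>. f i (Y t \<omega>)) = 0"
  shows "integrable M (\<lambda>\<omega>. ln (\<Sum>i\<in>I. exp (\<Sum>t=1..n. f i (Y t \<omega>))))" (is "integrable M (?g n)")
    and "expectation (\<lambda>\<omega>. ln (\<Sum>i\<in>I. exp (\<Sum>t=1..n. f i (Y t \<omega>))))
           \<le> ln (card I) + 4 * (\<Sum>t=1..n. expectation (\<lambda>\<omega>. (F (Y t \<omega>))\<^sup>2))"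
proof -
  have rv: "random_variable N (Y t)" if "t \<in> {1..n}" for t
    using indep that unfolding indep_vars_def2 by blast
  have F_int: "integrable M (\<lambda>\<omega>. F (Y t \<omega>))" if "t \<in> {1..n}" for t
    by (rule square_integrable_imp_integrable[OF measurable_compose[OF rv[OF that] F] F2[OF that]])
  have f_int: "integrable M (\<lambda>\<omega>. f i (Y t \<omega>))" if "t \<in> {1..n}" "i \<in> I" for t i
  proof (rule Bochner_Integration.integrable_bound[OF F_int[OF that(1)]])
    show "AE \<omega> in M. norm (f i (Y t \<omega>)) \<le> norm (F (Y t \<omega>))"
      using bound[OF that(2)] by (intro AE_I2) (smt (verit) real_norm_def)
  qed (rule measurable_compose[OF rv[OF that(1)] f[OF that(2)]])
  have g_int: "integrable M (?g m)" if "m \<le> n" for m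
  proof (rule Bochner_Integration.integrable_bound)
    have sub: "{1..m} \<subseteq> {1..n}"
      using that by auto
    show "integrable M (\<lambda>\<omega>. ln (card I) + (\<Sum>t=1..m. F (Y t \<omega>)))"
      by (intro Bochner_Integration.integrable_add Bochner_Integration.integrable_sum
          F_int subsetD[OF sub]) simp
    show "?g m \<in> borel_measurable M"
      by (intro borel_measurable_ln borel_measurable_sum measurable_compose[OF _ borel_measurable_exp]
          measurable_compose[OF rv f] subsetD[OF sub])
    show "AE \<omega> in M. norm (?g m \<omega>) \<le> norm (ln (card I) + (\<Sum>t=1..m. F (Y t \<omega>)))"
    proof (rule AE_I2)
      fix \<omega>
      have "\<bar>?g m \<omega>\<bar> \<le> ln (card I) + (\<Sum>t=1..m. F (Y t \<omega>))"
        using fin bound by (intro abs_ln_sum_exp_le order.trans[OF sum_abs] sum_mono) auto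
      then show "norm (?g m \<omega>) \<le> norm (ln (card I) + (\<Sum>t=1..m. F (Y t \<omega>)))"
        by simp
    qed
  qed
  then show "integrable M (?g n)"
    by simp
  have "expectation (?g m) \<le> ln (card I) + 4 * (\<Sum>t=1..m. expectation (\<lambda>\<omega>. (F (Y t \<omega>))\<^sup>2))"
    if "m \<le> n" for m
    using that
  proof (induction m)
    case 0
    then show ?case by (simp add: prob_space)
  next
    case (Suc m)
    \<comment> \<open>The weights are functions of a path r rather than of the sample point, so that
      they become measurable on the product of the first m coordinates and independence of disjoint
      index blocks applies.\<close>
    define p where "p i r = exp (\<Sum>t=1..m. f i (r t)) / (\<Sum>j\<in>I. exp (\<Sum>t=1..m. f j (r t)))" for i and r :: "nat \<Rightarrow> 'b"
    let ?p = "\<lambda>i \<omega>. p i (\<lambda>t. Y t \<omega>)" and ?y = "\<lambda>i \<omega>. f i (Y (Suc m) \<omega>)"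
    have Sm: "Suc m \<in> {1..n}"
      using Suc by auto
    have p_meas: "p i \<in> borel_measurable (PiM {1..m} (\<lambda>_. N))" if "i \<in> I" for i
      unfolding p_def using that
      by (intro borel_measurable_divide measurable_compose[OF _ borel_measurable_exp] borel_measurable_sum) (auto intro!: measurable_compose[OF _ f])
    have p_le: "\<bar>p i r\<bar> \<le> 1" if "i \<in> I" for i r
    proof -
      have "exp (\<Sum>t=1..m. f i (r t)) \<le> (\<Sum>j\<in>I. exp (\<Sum>t=1..m. f j (r t)))"
        using fin that by (intro member_le_sum) auto
      moreover have "0 < exp (\<Sum>t=1..m. f i (r t))"
        by simp
      ultimately show ?thesis
        unfolding p_def by (subst abs_of_nonneg) (auto simp: divide_le_eq_1 simp del: exp_gt_zero)
    qed
    have ind: "indep_var borel (?p i) borel (?y i)" if "i \<in> I" for i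
    proof -
      have "indep_var (PiM {1..m} (\<lambda>_. N)) (\<lambda>\<omega>. restrict (\<lambda>t. Y t \<omega>) {1..m})
              (PiM {Suc m} (\<lambda>_. N)) (\<lambda>\<omega>. restrict (\<lambda>t. Y t \<omega>) {Suc m})"
        using Suc.prems by (intro indep_var_restrict[OF indep]) auto
      from indep_var_compose[OF this p_meas[OF that], of "\<lambda>r. f i (r (Suc m))" borel]
      show ?thesis
        using that by (auto simp: comp_def p_def intro: measurable_compose[OF _ f])
    qed
    have p_int: "integrable M (?p i)" if "i \<in> I" for i
      using ind[OF that] p_le[OF that] by (intro integrable_const_bound[of _ 1]) (auto simp: indep_var_rv1)
    have py_int: "integrable M (\<lambda>\<omega>. ?p i \<omega> * ?y i \<omega>)"
      and py: "expectation (\<lambda>\<omega>. ?p i \<omega> * ?y i \<omega>) = 0" if "i \<in> I" for i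
      using indep_var_integrable[OF ind[OF that] p_int[OF that] f_int[OF Sm that]]
        indep_var_lebesgue_integral[OF ind[OF that] p_int[OF that] f_int[OF Sm that]]
        centred[OF that Sm] by auto
    have "expectation (?g (Suc m)) \<le>
        expectation (\<lambda>\<omega>. ?g m \<omega> + (\<Sum>i\<in>I. ?p i \<omega> * ?y i \<omega>) + 4 * (F (Y (Suc m) \<omega>))\<^sup>2)"
    proof (rule integral_mono)
      show "integrable M (\<lambda>\<omega>. ?g m \<omega> + (\<Sum>i\<in>I. ?p i \<omega> * ?y i \<omega>) + 4 * (F (Y (Suc m) \<omega>))\<^sup>2)"
        using g_int[of m] py_int F2[OF Sm] Suc.prems by auto
      fix \<omega>
      show "?g (Suc m) \<omega> \<le> ?g m \<omega> + (\<Sum>i\<in>I. ?p i \<omega> * ?y i \<omega>) + 4 * (F (Y (Suc m) \<omega>))\<^sup>2"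
        using ln_sum_exp_add_le[OF fin, of "\<lambda>i. ?y i \<omega>" "F (Y (Suc m) \<omega>)" "\<lambda>i. \<Sum>t=1..m. f i (Y t \<omega>)"] bound
        by (simp add: p_def)
    qed (rule g_int[OF Suc.prems])
    also have "\<dots> = expectation (?g m) + 4 * expectation (\<lambda>\<omega>. (F (Y (Suc m) \<omega>))\<^sup>2)"
      using g_int[of m] py_int py F2[OF Sm] Suc.prems by simp
    finally show ?case
      using Suc by simp
  qed
  then show "expectation (?g n) \<le> ln (card I) + 4 * (\<Sum>t=1..n. expectation (\<lambda>\<omega>. (F (Y t \<omega>))\<^sup>2))"
    by simp
qed

text \<open>The log-sum-exp dominates each of its exponents, so
  \<open>expectation_ln_sum_exp_le\<close>, applied to centred and rescaled real parts, bounds the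
  maximum. \<open>L\<close> may exceed ln (4 * card I), which lets the chaining insert a bound with
  a convenient square root.\<close>

lemma (in prob_space) nn_integral_max_normalized_sum_le:
  fixes h :: "'i \<Rightarrow> 'b \<Rightarrow> complex" and G :: "'b \<Rightarrow> real" and Y :: "nat \<Rightarrow> 'a \<Rightarrow> 'b"
  assumes fin: "finite I" "I \<noteq> {}"
    and n: "n \<ge> 1"
    and indep: "indep_vars (\<lambda>_. N) Y {1..n}"
    and ident: "\<And>t. t \<in> {1..n} \<Longrightarrow> distr M N (Y t) = distr M N (Y 1)"
    and h: "\<And>i. i \<in> I \<Longrightarrow> h i \<in> borel_measurable N"
    and G: "G \<in> borel_measurable N"
    and bound: "\<And>i y. i \<in> I \<Longrightarrow> cmod (h i y) \<le> G y"
    and G2: "integrable M (\<lambda>\<omega>. (G (Y 1 \<omega>))\<^sup>2)" "expectation (\<lambda>\<omega>. (G (Y 1 \<omega>))\<^sup>2) \<le> b\<^sup>2"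
    and b: "b > 0" and L: "L > 0" "ln (4 * real (card I)) \<le> L"
  shows "(\<integral>\<^sup>+\<omega>. (SUP i\<in>I. ennreal (cmod (complex_of_real (1 / sqrt n) *
            (\<Sum>t=1..n. h i (Y t \<omega>) - expectation (\<lambda>\<omega>. h i (Y 1 \<omega>)))))) \<partial>M) \<le> ennreal (34 * b * sqrt L)"
proof -
  \<comment> \<open>balances the two terms \<open>ln (4 * card I) / \<theta>\<close> and \<open>16 * \<theta> * n * b\<^sup>2\<close> of the scaled bound\<close>
  define \<theta> where "\<theta> = sqrt L / (b * sqrt n)"
  have \<theta>: "\<theta> > 0" and \<theta>2: "\<theta>\<^sup>2 * (n * b\<^sup>2) = L"
    using b L n by (auto simp: \<theta>_def power_divide power_mult_distrib)
  \<comment> \<open>\<open>Re (c * z)\<close> for \<open>c \<in> C\<close> runs through the real and imaginary parts of \<open>z\<close> and their negatives\<close>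
  define C where "C = {1, -1, \<i>, -\<i>}"
  have card_C: "card C = 4"
    by (simp add: C_def complex_eq_iff)
  define \<mu> where "\<mu> i = expectation (\<lambda>\<omega>. h i (Y 1 \<omega>))" for i
  define m where "m = expectation (\<lambda>\<omega>. G (Y 1 \<omega>))"
  define f where "f = (\<lambda>(i, c) y. \<theta> * Re (c * (h i y - \<mu> i)))"
  define F where "F y = \<theta> * (G y + m)" for y
  define D where "D i \<omega> = (\<Sum>t=1..n. h i (Y t \<omega>) - \<mu> i)" for i \<omega>
  let ?g = "\<lambda>\<omega>. ln (\<Sum>j\<in>I \<times> C. exp (\<Sum>t=1..n. f j (Y t \<omega>)))"

  have rv: "random_variable N (Y t)" if "t \<in> {1..n}" for t
    using indep that unfolding indep_vars_def2 by blast
  have one: "1 \<in> {1..n}"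
    using n by simp
  have integrable_ident: "integrable M (\<lambda>\<omega>. q (Y t \<omega>)) = integrable M (\<lambda>\<omega>. q (Y 1 \<omega>))"
    and expectation_ident: "expectation (\<lambda>\<omega>. q (Y t \<omega>)) = expectation (\<lambda>\<omega>. q (Y 1 \<omega>))"
    if "t \<in> {1..n}" "q \<in> borel_measurable N" for t and q :: "'b \<Rightarrow> 'd::{banach, second_countable_topology}"
    using integrable_distr_eq[OF rv[OF that(1)] that(2)] integrable_distr_eq[OF rv[OF one] that(2)]
      integral_distr[OF rv[OF that(1)] that(2)] integral_distr[OF rv[OF one] that(2)] ident[OF that(1)]
    by simp_all
  have G_int: "integrable M (\<lambda>\<omega>. G (Y 1 \<omega>))"
    by (rule square_integrable_imp_integrable[OF measurable_compose[OF rv[OF one] G] G2(1)])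
  have h_int: "integrable M (\<lambda>\<omega>. h i (Y 1 \<omega>))" if "i \<in> I" for i
  proof (rule Bochner_Integration.integrable_bound[OF G_int])
    show "AE \<omega> in M. norm (h i (Y 1 \<omega>)) \<le> norm (G (Y 1 \<omega>))"
      using bound[OF that] by (intro AE_I2) (smt (verit) real_norm_def)
  qed (rule measurable_compose[OF rv[OF one] h[OF that]])
  have \<mu>_le: "cmod (\<mu> i) \<le> m" if "i \<in> I" for i
    unfolding \<mu>_def m_def
    by (intro order.trans[OF integral_norm_bound] integral_mono G_int integrable_norm
        h_int[OF that] bound[OF that])
  \<comment> \<open>Nonnegativity of the variance of the envelope.\<close>
  have m2: "m\<^sup>2 \<le> b\<^sup>2"
    using variance_positive[of "\<lambda>\<omega>. G (Y 1 \<omega>)"] variance_eq[OF G_int G2(1)] G2(2)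
    unfolding m_def by linarith

  have F_sq: "(F y)\<^sup>2 \<le> 2 * \<theta>\<^sup>2 * ((G y)\<^sup>2 + m\<^sup>2)" for y
  proof -
    have "(G y + m)\<^sup>2 \<le> 2 * ((G y)\<^sup>2 + m\<^sup>2)"
      using sum_squares_bound[of "G y" m] by (simp add: power2_sum)
    then have "\<theta>\<^sup>2 * (G y + m)\<^sup>2 \<le> \<theta>\<^sup>2 * (2 * ((G y)\<^sup>2 + m\<^sup>2))"
      by (rule mult_left_mono) simp
    then show ?thesis
      by (simp only: F_def power_mult_distrib mult_ac)
  qed
  have F_meas: "F \<in> borel_measurable N"
    unfolding F_def using G by simp
  have F_int1: "integrable M (\<lambda>\<omega>. (F (Y 1 \<omega>))\<^sup>2)"
  proof -
    have "(\<lambda>\<omega>. (F (Y 1 \<omega>))\<^sup>2) = (\<lambda>\<omega>. \<theta>\<^sup>2 * ((G (Y 1 \<omega>))\<^sup>2 + 2 * m * G (Y 1 \<omega>) + m\<^sup>2))"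
      by (auto simp: F_def power_mult_distrib power2_sum mult_ac)
    then show ?thesis
      using G_int G2(1) by simp
  qed
  have F_int: "integrable M (\<lambda>\<omega>. (F (Y t \<omega>))\<^sup>2)"
    and F_exp: "expectation (\<lambda>\<omega>. (F (Y t \<omega>))\<^sup>2) \<le> 4 * \<theta>\<^sup>2 * b\<^sup>2" if "t \<in> {1..n}" for t
  proof -
    have meas: "(\<lambda>y. (F y)\<^sup>2) \<in> borel_measurable N"
      using F_meas by simp
    show "integrable M (\<lambda>\<omega>. (F (Y t \<omega>))\<^sup>2)"
      using integrable_ident[OF that meas] F_int1 by simp
    have "expectation (\<lambda>\<omega>. (F (Y t \<omega>))\<^sup>2) = expectation (\<lambda>\<omega>. (F (Y 1 \<omega>))\<^sup>2)"
      by (rule expectation_ident[OF that meas])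
    also have "\<dots> \<le> expectation (\<lambda>\<omega>. 2 * \<theta>\<^sup>2 * ((G (Y 1 \<omega>))\<^sup>2 + m\<^sup>2))"
      using G2(1) by (intro integral_mono F_int1 F_sq) simp
    also have "\<dots> = 2 * \<theta>\<^sup>2 * (expectation (\<lambda>\<omega>. (G (Y 1 \<omega>))\<^sup>2) + m\<^sup>2)"
      using G2(1) by (simp add: prob_space)
    also have "\<dots> \<le> 2 * \<theta>\<^sup>2 * (b\<^sup>2 + b\<^sup>2)"
      using G2(2) m2 by (intro mult_left_mono add_mono) auto
    finally show "expectation (\<lambda>\<omega>. (F (Y t \<omega>))\<^sup>2) \<le> 4 * \<theta>\<^sup>2 * b\<^sup>2"
      by simp
  qed

  have f_bound: "\<bar>f j y\<bar> \<le> F y" if "j \<in> I \<times> C" for j y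
  proof -
    obtain i c where j: "j = (i, c)" "i \<in> I" "c \<in> C"
      using \<open>j \<in> I \<times> C\<close> by auto
    have "\<bar>Re (c * (h i y - \<mu> i))\<bar> \<le> cmod (h i y - \<mu> i)"
      using abs_Re_le_cmod[of "c * (h i y - \<mu> i)"] j by (auto simp: C_def norm_mult)
    also have "\<dots> \<le> G y + m"
      using norm_triangle_ineq4[of "h i y" "\<mu> i"] bound[OF j(2), of y] \<mu>_le[OF j(2)] by simp
    finally show ?thesis
      using \<theta> by (simp add: f_def F_def j abs_mult mult_left_mono)
  qed
  have f_meas: "f j \<in> borel_measurable N" if "j \<in> I \<times> C" for j
    using that h by (auto simp: f_def)
  have f_centred: "expectation (\<lambda>\<omega>. f j (Y t \<omega>)) = 0" if "j \<in> I \<times> C" "t \<in> {1..n}" for j t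
  proof -
    obtain i c where j: "j = (i, c)" "i \<in> I"
      using \<open>j \<in> I \<times> C\<close> by auto
    have "expectation (\<lambda>\<omega>. f j (Y t \<omega>)) = expectation (\<lambda>\<omega>. f j (Y 1 \<omega>))"
      by (rule expectation_ident[OF that(2) f_meas[OF that(1)]])
    also have "\<dots> = \<theta> * Re (expectation (\<lambda>\<omega>. c * (h i (Y 1 \<omega>) - \<mu> i)))"
      using h_int[OF j(2)] by (simp add: f_def j)
    also have "expectation (\<lambda>\<omega>. c * (h i (Y 1 \<omega>) - \<mu> i)) = 0"
      using h_int[OF j(2)] by (simp add: \<mu>_def prob_space)
    finally show ?thesis by simp
  qed
  have finC: "finite (I \<times> C)" "I \<times> C \<noteq> {}"
    using fin by (auto simp: C_def)
  have max: "integrable M ?g"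
    "expectation ?g \<le> ln (card (I \<times> C)) + 4 * (\<Sum>t=1..n. expectation (\<lambda>\<omega>. (F (Y t \<omega>))\<^sup>2))"
    by (rule expectation_ln_sum_exp_le[OF finC indep, where F=F and f=f];
        (rule f_meas F_meas f_bound F_int f_centred; assumption?))+
  \<comment> \<open>The log-sum-exp bound has factor 4 and the centred envelope has second moment at
    most 4 * \<theta>^2 * b^2. With \<theta>^2 * n * b^2 = L this gives L + 16 * L = 17 * L.\<close>
  have "expectation ?g \<le> ln (card (I \<times> C)) + 4 * (\<Sum>t=1..n. 4 * \<theta>\<^sup>2 * b\<^sup>2)"
    by (intro order.trans[OF max(2)] add_left_mono mult_left_mono sum_mono F_exp) auto
  also have "\<dots> \<le> L + 16 * (\<theta>\<^sup>2 * (n * b\<^sup>2))"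
    using L(2) by (simp add: card_cartesian_product card_C mult_ac)
  finally have g_exp: "expectation ?g \<le> 17 * L"
    by (simp add: \<theta>2)

  have g_ge: "\<theta> * Re (c * D i \<omega>) \<le> ?g \<omega>" if "i \<in> I" "c \<in> C" for i c \<omega>
  proof -
    have "exp (\<Sum>t=1..n. f (i, c) (Y t \<omega>)) \<le> (\<Sum>j\<in>I \<times> C. exp (\<Sum>t=1..n. f j (Y t \<omega>)))"
      using finC that by (intro member_le_sum[where f="\<lambda>j. exp (\<Sum>t=1..n. f j (Y t \<omega>))"]) auto
    then have "(\<Sum>t=1..n. f (i, c) (Y t \<omega>)) \<le> ?g \<omega>"
      by (simp only: ln_ge_iff less_le_trans[OF exp_gt_zero])
    moreover have "(\<Sum>t=1..n. f (i, c) (Y t \<omega>)) = \<theta> * Re (c * D i \<omega>)"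
      by (simp only: f_def D_def prod.case sum_distrib_left Re_sum)
    ultimately show ?thesis by simp
  qed
  \<comment> \<open>The factor 2 pays for bounding the modulus by real plus imaginary part; it turns
    17 into the final 34.\<close>
  have D_le: "\<theta> * cmod (D i \<omega>) \<le> 2 * ?g \<omega>" if "i \<in> I" for i \<omega>
  proof -
    have "\<theta> * cmod (D i \<omega>) \<le> \<theta> * (\<bar>Re (D i \<omega>)\<bar> + \<bar>Im (D i \<omega>)\<bar>)"
      using \<theta> cmod_le by (intro mult_left_mono) auto
    moreover have "\<theta> * \<bar>Re (D i \<omega>)\<bar> \<le> ?g \<omega>"
      using g_ge[OF that, of 1 \<omega>] g_ge[OF that, of "-1" \<omega>] by (auto simp: C_def abs_if)
    moreover have "\<theta> * \<bar>Im (D i \<omega>)\<bar> \<le> ?g \<omega>"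
      using g_ge[OF that, of "\<i>" \<omega>] g_ge[OF that, of "-\<i>" \<omega>] by (auto simp: C_def abs_if)
    ultimately show ?thesis
      by (simp add: distrib_left)
  qed
  \<comment> \<open>Lets the nonnegative integral of the log-sum-exp be replaced by its
    expectation.\<close>
  have g_nonneg: "0 \<le> ?g \<omega>" for \<omega>
  proof -
    obtain i where "i \<in> I"
      using fin by auto
    have "0 \<le> \<theta> * cmod (D i \<omega>)"
      using \<theta> by simp
    with D_le[OF \<open>i \<in> I\<close>, of \<omega>] show ?thesis by linarith
  qed

  have "(\<integral>\<^sup>+\<omega>. (SUP i\<in>I. ennreal (cmod (complex_of_real (1 / sqrt n) * D i \<omega>))) \<partial>M)
      \<le> (\<integral>\<^sup>+\<omega>. ennreal (2 * b / sqrt L * ?g \<omega>) \<partial>M)"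
  proof (intro nn_integral_mono SUP_least ennreal_leI)
    fix i \<omega> assume "i \<in> I"
    have "cmod (complex_of_real (1 / sqrt n) * D i \<omega>) = (\<theta> * cmod (D i \<omega>)) * (b / sqrt L)"
      using n b L by (simp add: \<theta>_def norm_mult norm_divide)
    also have "\<dots> \<le> (2 * ?g \<omega>) * (b / sqrt L)"
      using D_le[OF \<open>i \<in> I\<close>, of \<omega>] b L by (intro mult_right_mono) auto
    finally show "cmod (complex_of_real (1 / sqrt n) * D i \<omega>) \<le> 2 * b / sqrt L * ?g \<omega>"
      by (simp add: mult_ac)
  qed
  also have "\<dots> = ennreal (expectation (\<lambda>\<omega>. 2 * b / sqrt L * ?g \<omega>))"
    using max(1) b L g_nonneg by (intro nn_integral_eq_integral) auto
  also have "\<dots> = ennreal (2 * b / sqrt L * expectation ?g)"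
    by (subst integral_mult_right_zero) (rule refl)
  also have "\<dots> \<le> ennreal (2 * b / sqrt L * (17 * L))"
    using g_exp b L by (intro ennreal_leI mult_left_mono) auto
  also have "2 * b / sqrt L * (17 * L) = 34 * b * sqrt L"
    using L by (simp add: field_simps)
  finally show ?thesis
    by (simp add: D_def \<mu>_def)
qed

subsection \<open>Dyadic chaining\<close>

text \<open>The integer points start the chains and level k links a grid point to its right-hand
  midpoint. The other child, 2l / 2^(k+1), equals its parent and costs nothing. Being a countable
  sum of finite maxima, the functional inherits measurability from the process.\<close>

definition dyadic_majorant :: "nat \<Rightarrow> (real \<Rightarrow> complex) \<Rightarrow> ennreal" where
  "dyadic_majorant m c =
     (SUP l\<in>{- (2 ^ m)..2 ^ m :: int}. ennreal (cmod (c (of_int l)))) +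
     (\<Sum>k. SUP l\<in>{- (2 ^ (m + k))..2 ^ (m + k) :: int}.
        ennreal (cmod (c (of_int (2 * l + 1) / 2 ^ Suc k) - c (of_int l / 2 ^ k))))"

text \<open>Rounding U down to multiples of 2^(-k) gives a chain from an integer to U. Telescoping
  bounds c along the chain, and continuity passes to the limit.\<close>

lemma norm_le_dyadic_majorant:
  assumes c: "continuous_on UNIV c" and U: "\<bar>U\<bar> \<le> 2 ^ m"
  shows "ennreal (cmod (c U)) \<le> dyadic_majorant m c"
proof -
  define A where "A = (SUP l\<in>{- (2 ^ m)..2 ^ m :: int}. ennreal (cmod (c (of_int l))))"
  define B where "B k = (SUP l\<in>{- (2 ^ (m + k))..2 ^ (m + k) :: int}.
        ennreal (cmod (c (of_int (2 * l + 1) / 2 ^ Suc k) - c (of_int l / 2 ^ k))))" for k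
  define l where "l k = \<lfloor>2 ^ k * U\<rfloor>" for k :: nat
  define u where "u k = (of_int (l k) / 2 ^ k :: real)" for k
  have l_range: "l k \<in> {- (2 ^ (m + k))..2 ^ (m + k)}" for k
  proof -
    have "\<bar>2 ^ k * U\<bar> \<le> 2 ^ (m + k)"
      using U by (simp add: abs_mult power_add mult.commute)
    then have "- (2 ^ (m + k)) \<le> 2 ^ k * U" "2 ^ k * U \<le> 2 ^ (m + k)"
      by linarith+
    then have "real_of_int (- (2 ^ (m + k))) \<le> 2 ^ k * U"
      and "real_of_int \<lfloor>2 ^ k * U\<rfloor> \<le> real_of_int (2 ^ (m + k))"
      by (simp_all only: of_int_minus of_int_power of_int_numeral order.trans[OF of_int_floor_le])
    then show ?thesis
      by (simp only: l_def le_floor_iff of_int_le_iff atLeastAtMost_iff)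
  qed
  \<comment> \<open>Each refinement either stays at the same point or moves to the midpoint listed
    at level k.\<close>
  have l_Suc: "l (Suc k) = 2 * l k \<or> l (Suc k) = 2 * l k + 1" for k
  proof -
    have "2 ^ Suc k * U = 2 * (2 ^ k * U)"
      by simp
    then show ?thesis
      unfolding l_def by linarith
  qed
  have partial: "ennreal (cmod (c (u k))) \<le> A + (\<Sum>i<k. B i)" for k
  proof (induction k)
    case 0
    show ?case
      unfolding A_def u_def using l_range[of 0] by (auto intro!: SUP_upper2[of "l 0"])
  next
    case (Suc k)
    have "ennreal (cmod (c (u (Suc k)) - c (u k))) \<le> B k"
      using l_Suc[of k]
    proof
      assume "l (Suc k) = 2 * l k"
      then have "u (Suc k) = u k"
        by (simp add: u_def)
      then show ?thesis by simp
    next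
      assume "l (Suc k) = 2 * l k + 1"
      then show ?thesis
        unfolding B_def u_def by (intro SUP_upper2[OF l_range[of k]]) simp
    qed
    moreover have "ennreal (cmod (c (u (Suc k)))) \<le>
        ennreal (cmod (c (u k))) + ennreal (cmod (c (u (Suc k)) - c (u k)))"
      using norm_triangle_ineq[of "c (u k)" "c (u (Suc k)) - c (u k)"]
      by (simp flip: ennreal_plus)
    ultimately show ?case
      using Suc by (simp add: add.assoc [symmetric]) (meson add_mono order.trans)
  qed
  have "u \<longlonglongrightarrow> U"
  proof (rule LIMSEQ_I)
    have "\<bar>u k - U\<bar> \<le> (1 / 2) ^ k" for k
    proof -
      have "\<bar>of_int (l k) - 2 ^ k * U\<bar> \<le> 1"
        unfolding l_def by linarith
      moreover have "u k - U = (of_int (l k) - 2 ^ k * U) / 2 ^ k"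
        by (simp add: u_def field_simps)
      ultimately show ?thesis
        by (simp add: abs_divide power_one_over divide_right_mono)
    qed
    moreover fix r :: real assume "r > 0"
    then obtain N where "(1 / 2) ^ N < r"
      using real_arch_pow_inv[of r "1/2"] by auto
    moreover have "(1 / 2 :: real) ^ k \<le> (1 / 2) ^ N" if "N \<le> k" for k
      using that by (intro power_decreasing) auto
    ultimately show "\<exists>N. \<forall>k\<ge>N. norm (u k - U) < r"
      by (metis le_less_trans real_norm_def)
  qed
  moreover have "isCont c U"
    using c by (simp add: continuous_on_eq_continuous_at)
  ultimately have "(\<lambda>k. c (u k)) \<longlonglongrightarrow> c U"
    by (metis isCont_tendsto_compose)
  then have "(\<lambda>k. ennreal (cmod (c (u k)))) \<longlonglongrightarrow> ennreal (cmod (c U))"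
    by (intro tendsto_ennrealI tendsto_norm)
  moreover have "ennreal (cmod (c (u k))) \<le> A + (\<Sum>i. B i)" for k
    using partial[of k] sum_le_suminf[of B "{..<k}"] by (auto intro: order.trans add_left_mono)
  ultimately have "ennreal (cmod (c U)) \<le> A + (\<Sum>i. B i)"
    by (metis LIMSEQ_le_const2)
  then show ?thesis
    by (simp add: dyadic_majorant_def A_def B_def)
qed

section \<open>Moment bounds for the scalar process, uniform in n\<close>

definition real_ecf_process :: "'w measure \<Rightarrow> (nat \<Rightarrow> 'w \<Rightarrow> real) \<Rightarrow> nat \<Rightarrow> 'w \<Rightarrow> real \<Rightarrow> complex" where
  "real_ecf_process M Y n \<omega> U = complex_of_real (1 / sqrt (real n)) *
     (\<Sum>t = 1..n. iexp (U * Y t \<omega>) - (\<integral>\<omega>'. iexp (U * Y 1 \<omega>') \<partial>M))"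

lemma cmod_iexp_diff_le: "cmod (iexp a - iexp b) \<le> \<bar>a - b\<bar>"
proof -
  have "iexp a - iexp b = iexp b * (iexp (a - b) - 1)"
    by (simp add: algebra_simps flip: exp_add)
  then show ?thesis
    using iexp_approx1[of "a - b" 0] by (simp add: norm_mult)
qed

text \<open>The cardinality times 4 is at most 2^(m + k + 4), and m + k + 4 <= m * (k + 5) because
  (m - 1) * (k + 4) >= 0. The further squaring makes the square root split into sqrt m times k +
  5.\<close>

lemma ln_4_card_symmetric_interval_le:
  assumes "m \<ge> 1"
  shows "ln (4 * real (card {- (2 ^ (m + k))..2 ^ (m + k) :: int})) \<le> real m * (real k + 5)\<^sup>2"
proof -
  have card: "card {- (2 ^ (m + k))..2 ^ (m + k) :: int} = 2 * 2 ^ (m + k) + 1"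
    by (simp add: nat_add_distrib nat_mult_distrib nat_power_eq)
  have "4 * real (card {- (2 ^ (m + k))..2 ^ (m + k) :: int}) \<le> 2 ^ (m + k + 4)"
  proof -
    have "4 * (2 * x + 1) \<le> x * 16" if "1 \<le> x" for x :: real
      using that by simp
    from this[of "2 ^ (m + k)"] show ?thesis
      unfolding card power_add[of _ "m + k" 4] by simp
  qed
  then have "ln (4 * real (card {- (2 ^ (m + k))..2 ^ (m + k) :: int})) \<le> ln (2 ^ (m + k + 4))"
    by (intro ln_mono) (auto simp: card intro!: add_nonneg_pos)
  also have "\<dots> = (real m + real k + 4) * ln 2"
    by (simp add: ln_realpow)
  also have "\<dots> \<le> (real m + real k + 4) * 1"
    using ln_2_less_1 by (intro mult_left_mono) auto
  also have "\<dots> \<le> real m * (real k + 5)"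
  proof -
    have "0 \<le> (real m - 1) * (real k + 4)"
      using assms by simp
    then show ?thesis by (simp add: algebra_simps)
  qed
  also have "\<dots> \<le> real m * (real k + 5)\<^sup>2"
    by (intro mult_left_mono) (auto simp: self_le_power)
  finally show ?thesis .
qed

lemma suminf_dyadic_entropy_le: "(\<Sum>k. ennreal ((real k + 5) / 2 ^ Suc k)) \<le> 6"
proof -
  \<comment> \<open>The sum telescopes: (k + 5) / 2^(k+1) = (k + 6) / 2^k - (k + 7) /
    2^(k+1).\<close>
  have "(\<Sum>k<N. (real k + 5) / 2 ^ Suc k) = 6 - (real N + 6) / 2 ^ N" for N
    by (induction N) (simp_all add: field_simps)
  then have "(\<Sum>k<N. (real k + 5) / 2 ^ Suc k) \<le> 6" for N
    by (simp only:) simp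
  then have "(\<Sum>k<N. ennreal ((real k + 5) / 2 ^ Suc k)) \<le> ennreal 6" for N
    by (subst sum_ennreal) (simp, rule ennreal_leI)
  then show ?thesis
    unfolding suminf_eq_SUP by (auto intro!: SUP_least)
qed

text \<open>\<sigma> is any positive upper bound for the L2 norm rather than the norm itself: the
  maximal inequality asks for b > 0, and Y may vanish almost surely.\<close>

locale iid_real = prob_space +
  fixes Y :: "nat \<Rightarrow> 'a \<Rightarrow> real" and \<sigma> :: real
  assumes indep: "indep_vars (\<lambda>_. borel) Y {1..}"
    and ident: "\<And>t. t \<ge> 1 \<Longrightarrow> distr M borel (Y t) = distr M borel (Y 1)"
    and square_integrable: "integrable M (\<lambda>\<omega>. (Y 1 \<omega>)\<^sup>2)"
    and second_moment_le: "expectation (\<lambda>\<omega>. (Y 1 \<omega>)\<^sup>2) \<le> \<sigma>\<^sup>2"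
    and \<sigma>_pos: "\<sigma> > 0"
begin

lemma Y_measurable: "t \<ge> 1 \<Longrightarrow> random_variable borel (Y t)"
  using indep unfolding indep_vars_def2 by blast

lemma iexp_integrable: "complex_integrable M (\<lambda>\<omega>. iexp (U * Y 1 \<omega>))"
  using Y_measurable[of 1] by (intro integrable_iexp) auto

lemma real_ecf_process_measurable: "(\<lambda>\<omega>. real_ecf_process M Y n \<omega> U) \<in> borel_measurable M"
  unfolding real_ecf_process_def using Y_measurable
  by (intro borel_measurable_times borel_measurable_sum borel_measurable_diff borel_measurable_const) auto

text \<open>The centring term is the characteristic function of the law of \<open>Y 1\<close>, hence
  continuous.\<close>

lemma continuous_real_ecf_process: "continuous_on UNIV (real_ecf_process M Y n \<omega>)"
proof -
  interpret D: real_distribution "distr M borel (Y 1)"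
    using Y_measurable[of 1] by simp
  have "(\<lambda>U. \<integral>\<omega>'. iexp (U * Y 1 \<omega>') \<partial>M) = char (distr M borel (Y 1))"
    using Y_measurable[of 1] by (auto simp: char_def integral_distr)
  then have *: "continuous_on UNIV (\<lambda>U. \<integral>\<omega>'. iexp (U * Y 1 \<omega>') \<partial>M)"
    by (simp only: continuous_on_eq_continuous_at[OF open_UNIV] D.isCont_char simp_thms ball_UNIV)
  show ?thesis
    unfolding real_ecf_process_def by (intro continuous_intros *)
qed

text \<open>Envelope 1 and the cardinality bound at k = 0, with square root 5 * sqrt m; 170 = 34 *
  5.\<close>

lemma nn_integral_max_ecf_le:
  assumes "n \<ge> 1" "m \<ge> 1"
  shows "(\<integral>\<^sup>+\<omega>. (SUP l\<in>{- (2 ^ m)..2 ^ m :: int}.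
            ennreal (cmod (real_ecf_process M Y n \<omega> (of_int l)))) \<partial>M) \<le> ennreal (170 * sqrt m)"
proof -
  have "(\<integral>\<^sup>+\<omega>. (SUP l\<in>{- (2 ^ m)..2 ^ m :: int}.
      ennreal (cmod (complex_of_real (1 / sqrt n) *
            (\<Sum>t=1..n. iexp (of_int l * Y t \<omega>) - expectation (\<lambda>\<omega>. iexp (of_int l * Y 1 \<omega>)))))) \<partial>M)
      \<le> ennreal (34 * 1 * sqrt (real m * 5\<^sup>2))"
    using assms ln_4_card_symmetric_interval_le[OF assms(2), of 0]
    by (intro nn_integral_max_normalized_sum_le[where N=borel and G="\<lambda>_. 1"]
        indep_vars_subset[OF indep] ident) (auto simp: prob_space)
  then show ?thesis
    by (simp add: real_ecf_process_def real_sqrt_mult)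
qed

text \<open>A link of length 2^(-(k+1)) has envelope |y| / 2^(k+1), of L2 norm at most \<sigma> /
  2^(k+1), which beats the growth k + 5 of the root of the cardinality bound.\<close>

lemma nn_integral_max_ecf_increment_le:
  assumes "n \<ge> 1" "m \<ge> 1"
  shows "(\<integral>\<^sup>+\<omega>. (SUP l\<in>{- (2 ^ (m + k))..2 ^ (m + k) :: int}.
            ennreal (cmod (real_ecf_process M Y n \<omega> (of_int (2 * l + 1) / 2 ^ Suc k) -
              real_ecf_process M Y n \<omega> (of_int l / 2 ^ k)))) \<partial>M)
         \<le> ennreal (34 * \<sigma> * sqrt m) * ennreal ((real k + 5) / 2 ^ Suc k)"
proof -
  define u v where "u l = (of_int l / 2 ^ k :: real)" and "v l = (of_int (2 * l + 1) / 2 ^ Suc k :: real)" for l :: int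
  define h where "h l y = iexp (v l * y) - iexp (u l * y)" for l y
  have "v l - u l = 1 / 2 ^ Suc k" for l
    by (simp add: u_def v_def field_simps)
  then have bound: "cmod (h l y) \<le> 1 / 2 ^ Suc k * \<bar>y\<bar>" for l y
    using cmod_iexp_diff_le[of "v l * y" "u l * y"]
    by (simp add: h_def abs_mult flip: left_diff_distrib)
  have diff: "real_ecf_process M Y n \<omega> (v l) - real_ecf_process M Y n \<omega> (u l) =
      complex_of_real (1 / sqrt n) * (\<Sum>t=1..n. h l (Y t \<omega>) - expectation (\<lambda>\<omega>. h l (Y 1 \<omega>)))" for l \<omega>
  proof -
    have "expectation (\<lambda>\<omega>. h l (Y 1 \<omega>)) = expectation (\<lambda>\<omega>. iexp (v l * Y 1 \<omega>)) - expectation (\<lambda>\<omega>. iexp (u l * Y 1 \<omega>))"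
      unfolding h_def by (intro Bochner_Integration.integral_diff iexp_integrable)
    then show ?thesis
      unfolding real_ecf_process_def right_diff_distrib [symmetric] sum_subtractf [symmetric]
      by (intro arg_cong[where f="(*) _"] sum.cong refl) (simp only: h_def, simp)
  qed
  have "(\<integral>\<^sup>+\<omega>. (SUP l\<in>{- (2 ^ (m + k))..2 ^ (m + k) :: int}.
      ennreal (cmod (complex_of_real (1 / sqrt n) *
            (\<Sum>t=1..n. h l (Y t \<omega>) - expectation (\<lambda>\<omega>. h l (Y 1 \<omega>)))))) \<partial>M)
      \<le> ennreal (34 * (\<sigma> / 2 ^ Suc k) * sqrt (real m * (real k + 5)\<^sup>2))"
  proof (rule nn_integral_max_normalized_sum_le[where N=borel and G="\<lambda>y. 1 / 2 ^ Suc k * \<bar>y\<bar>"])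
    show "indep_vars (\<lambda>_. borel) Y {1..n}"
      by (rule indep_vars_subset[OF indep]) auto
    show "integrable M (\<lambda>\<omega>. (1 / 2 ^ Suc k * \<bar>Y 1 \<omega>\<bar>)\<^sup>2)"
      using square_integrable by (simp add: power_mult_distrib power_divide)
    show "expectation (\<lambda>\<omega>. (1 / 2 ^ Suc k * \<bar>Y 1 \<omega>\<bar>)\<^sup>2) \<le> (\<sigma> / 2 ^ Suc k)\<^sup>2"
      using second_moment_le by (simp add: power_mult_distrib power_divide divide_right_mono)
    show "ln (4 * real (card {- (2 ^ (m + k))..2 ^ (m + k) :: int})) \<le> real m * (real k + 5)\<^sup>2"
      by (rule ln_4_card_symmetric_interval_le[OF assms(2)])
    show "cmod (h l y) \<le> 1 / 2 ^ Suc k * \<bar>y\<bar>" for l y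
      by (rule bound)
    show "h l \<in> borel_measurable borel" for l
      unfolding h_def by measurable
    show "distr M borel (Y t) = distr M borel (Y 1)" if "t \<in> {1..n}" for t
      using that by (intro ident) simp
    show "0 < real m * (real k + 5)\<^sup>2"
      using assms by (intro mult_pos_pos zero_less_power) auto
  qed (use assms \<sigma>_pos in auto)
  also have "34 * (\<sigma> / 2 ^ Suc k) * sqrt (real m * (real k + 5)\<^sup>2) = (34 * \<sigma> * sqrt m) * ((real k + 5) / 2 ^ Suc k)"
    by (simp add: real_sqrt_mult)
  finally show ?thesis
    unfolding diff [symmetric] u_def v_def using \<sigma>_pos by (subst ennreal_mult [symmetric]) auto
qed

lemma dyadic_majorant_measurable:
  "(\<lambda>\<omega>. dyadic_majorant m (real_ecf_process M Y n \<omega>)) \<in> borel_measurable M"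
  unfolding dyadic_majorant_def
  by (intro borel_measurable_add borel_measurable_suminf_order borel_measurable_SUP
      measurable_compose[OF _ measurable_ennreal] measurable_compose[OF _ borel_measurable_norm]
      borel_measurable_diff real_ecf_process_measurable countable_finite) auto

lemma nn_integral_dyadic_majorant_le:
  assumes "n \<ge> 1" "m \<ge> 1"
  shows "(\<integral>\<^sup>+\<omega>. dyadic_majorant m (real_ecf_process M Y n \<omega>) \<partial>M) \<le> ennreal ((170 + 204 * \<sigma>) * sqrt m)"
proof -
  define A where "A \<omega> = (SUP l\<in>{- (2 ^ m)..2 ^ m :: int}. ennreal (cmod (real_ecf_process M Y n \<omega> (of_int l))))" for \<omega>
  define B where "B k \<omega> = (SUP l\<in>{- (2 ^ (m + k))..2 ^ (m + k) :: int}.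
        ennreal (cmod (real_ecf_process M Y n \<omega> (of_int (2 * l + 1) / 2 ^ Suc k) -
          real_ecf_process M Y n \<omega> (of_int l / 2 ^ k))))" for k \<omega>
  have meas: "A \<in> borel_measurable M" "\<And>k. B k \<in> borel_measurable M"
    unfolding A_def B_def
    by (intro borel_measurable_SUP measurable_compose[OF _ measurable_ennreal]
        measurable_compose[OF _ borel_measurable_norm] borel_measurable_diff real_ecf_process_measurable countable_finite; simp)+
  have "(\<integral>\<^sup>+\<omega>. dyadic_majorant m (real_ecf_process M Y n \<omega>) \<partial>M) = (\<integral>\<^sup>+\<omega>. A \<omega> \<partial>M) + (\<Sum>k. \<integral>\<^sup>+\<omega>. B k \<omega> \<partial>M)"
    unfolding dyadic_majorant_def A_def [symmetric] B_def [symmetric]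
    using meas by (simp add: nn_integral_add nn_integral_suminf)
  also have "\<dots> \<le> ennreal (170 * sqrt m) + (\<Sum>k. ennreal (34 * \<sigma> * sqrt m) * ennreal ((real k + 5) / 2 ^ Suc k))"
    unfolding A_def B_def
    by (intro add_mono suminf_le nn_integral_max_ecf_le nn_integral_max_ecf_increment_le assms) auto
  \<comment> \<open>The links sum to at most 6, whence 204 = 34 * 6.\<close>
  also have "\<dots> \<le> ennreal (170 * sqrt m) + ennreal (34 * \<sigma> * sqrt m) * 6"
    unfolding ennreal_suminf_cmult by (intro add_left_mono mult_left_mono suminf_dyadic_entropy_le) auto
  also have "\<dots> = ennreal (170 * sqrt m) + ennreal (34 * \<sigma> * sqrt m) * ennreal 6"
    by simp
  also have "\<dots> = ennreal ((170 + 204 * \<sigma>) * sqrt m)"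
    using \<sigma>_pos by (subst ennreal_mult [symmetric], simp, simp, subst ennreal_plus [symmetric])
      (auto simp: algebra_simps)
  finally show ?thesis .
qed

end

subsection \<open>The logarithmic weight\<close>

text \<open>For j >= 1, ln (2^(2^(j-1))) = 2^(j-1) * ln 2 >= 2^j / 4; for j = 0 the logarithm is at
  least 1. The negative exponent reverses the inequality.\<close>

lemma log_weight_le:
  assumes "\<delta> > 0" and U: "j = 0 \<or> 2 ^ 2 ^ (j - 1) < \<bar>U\<bar>"
  shows "log_weight \<delta> U \<le> (2 ^ j / 4) powr (- 1 / 2 - \<delta>)"
proof -
  have "2 ^ j / 4 \<le> ln (exp 1 + \<bar>U\<bar>)"
  proof (cases "j = 0")
    case True
    have "ln (exp 1) \<le> ln (exp 1 + \<bar>U\<bar>)"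
      by (intro ln_mono) (auto intro: add_pos_nonneg)
    then show ?thesis
      using True by simp
  next
    case False
    then have "2 ^ j / 4 = 2 ^ (j - 1) * (1 / 2 :: real)"
      by (cases j) auto
    also have "\<dots> \<le> 2 ^ (j - 1) * ln 2"
      using ln2_ge_two_thirds by (intro mult_left_mono) auto
    also have "\<dots> = ln (2 ^ 2 ^ (j - 1))"
      by (simp add: ln_realpow)
    also have "\<dots> \<le> ln (exp 1 + \<bar>U\<bar>)"
    proof (rule ln_mono)
      show "2 ^ 2 ^ (j - 1) \<le> exp 1 + \<bar>U\<bar>"
        using U False exp_gt_zero[of "1::real"] by linarith
    qed simp
    finally show ?thesis .
  qed
  then show ?thesis
    unfolding log_weight_def using assms(1) by (intro powr_mono2') auto
qed

lemma weighted_norm_le_suminf_dyadic: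
  assumes "\<delta> > 0" and c: "continuous_on UNIV c"
  shows "ennreal (cmod (c U) * log_weight \<delta> U)
     \<le> (\<Sum>j. ennreal ((2 ^ j / 4) powr (- 1 / 2 - \<delta>)) * dyadic_majorant (2 ^ j) c)"
proof -
  \<comment> \<open>The first block containing U: minimality keeps |U| above the preceding bound, so
    the weight is small there. The case j = 0 has no predecessor and stays separate.\<close>
  define j where "j = (LEAST j. \<bar>U\<bar> \<le> 2 ^ 2 ^ j)"
  obtain p where "\<bar>U\<bar> < 2 ^ p"
    using real_arch_pow[of 2 "\<bar>U\<bar>"] by auto
  also have "(2::real) ^ p \<le> 2 ^ 2 ^ p"
    by (intro power_increasing) (auto intro: less_imp_le)
  finally have "\<bar>U\<bar> \<le> 2 ^ 2 ^ p"
    by simp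
  then have U: "\<bar>U\<bar> \<le> 2 ^ 2 ^ j"
    unfolding j_def by (rule LeastI)
  have "j = 0 \<or> 2 ^ 2 ^ (j - 1) < \<bar>U\<bar>"
    using not_less_Least[of "j - 1" "\<lambda>j. \<bar>U\<bar> \<le> 2 ^ 2 ^ j"] unfolding j_def [symmetric] by force
  then have "log_weight \<delta> U \<le> (2 ^ j / 4) powr (- 1 / 2 - \<delta>)"
    by (rule log_weight_le[OF assms(1)])
  then have "cmod (c U) * log_weight \<delta> U \<le> (2 ^ j / 4) powr (- 1 / 2 - \<delta>) * cmod (c U)"
    by (subst mult.commute) (rule mult_right_mono, auto)
  then have "ennreal (cmod (c U) * log_weight \<delta> U)
      \<le> ennreal ((2 ^ j / 4) powr (- 1 / 2 - \<delta>)) * ennreal (cmod (c U))"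
    by (subst ennreal_mult [symmetric]) (auto intro: ennreal_leI)
  also have "\<dots> \<le> ennreal ((2 ^ j / 4) powr (- 1 / 2 - \<delta>)) * dyadic_majorant (2 ^ j) c"
    by (intro mult_left_mono norm_le_dyadic_majorant c U) simp
  also have "\<dots> \<le> (\<Sum>j. ennreal ((2 ^ j / 4) powr (- 1 / 2 - \<delta>)) * dyadic_majorant (2 ^ j) c)"
    using sum_le_suminf[of "\<lambda>j. ennreal ((2 ^ j / 4) powr (- 1 / 2 - \<delta>)) * dyadic_majorant (2 ^ j) c" "{j}"]
    by simp
  finally show ?thesis .
qed

text \<open>The exponent -1/2 of the weight cancels the growth sqrt m of the majorant at m = 2^j;
  the surplus \<delta> gives geometric decay.\<close>

lemma powr_times_sqrt_dyadic:
  "(2 ^ j / 4) powr (- 1 / 2 - \<delta>) * sqrt (2 ^ j) = 4 powr (1 / 2 + \<delta>) * (2 powr (- \<delta>)) ^ j" for \<delta> :: real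
proof -
  have "(2 ^ j / 4) powr (- 1 / 2 - \<delta>) * sqrt (2 ^ j) =
      (2 powr j) powr (- 1 / 2 - \<delta>) / 4 powr (- 1 / 2 - \<delta>) * (2 powr j) powr (1 / 2)"
    by (simp add: powr_divide powr_realpow powr_half_sqrt)
  also have "\<dots> = (2 powr (j * (- 1 / 2 - \<delta>)) * 2 powr (j / 2)) * 4 powr (1 / 2 + \<delta>)"
    using powr_minus_divide[of 4 "1 / 2 + \<delta>"] by (simp add: powr_powr)
  also have "2 powr (j * (- 1 / 2 - \<delta>)) * 2 powr (j / 2) = 2 powr (- \<delta> * j)"
    by (simp add: algebra_simps flip: powr_add)
  also have "2 powr (- \<delta> * j) = (2 powr (- \<delta>)) ^ j"
    by (simp add: powr_realpow [symmetric] powr_powr)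
  finally show ?thesis by simp
qed

section \<open>Passage from the planar vectors to the scalar process\<close>

lemma integrable_norm_squared_of_powr:
  fixes X :: "'w \<Rightarrow> 'b::real_normed_vector"
  assumes "finite_measure M" "(\<lambda>\<omega>. norm (X \<omega>)) \<in> borel_measurable M" "\<gamma> > 0"
    and "integrable M (\<lambda>\<omega>. norm (X \<omega>) powr (2 + \<gamma>))"
  shows "integrable M (\<lambda>\<omega>. (norm (X \<omega>))\<^sup>2)"
proof (rule Bochner_Integration.integrable_bound)
  interpret finite_measure M by fact
  \<comment> \<open>The constant 1 dominates the square where the norm is at most 1, the higher
    power elsewhere.\<close>
  show "integrable M (\<lambda>\<omega>. 1 + norm (X \<omega>) powr (2 + \<gamma>))"
    using assms(4) by simp
  show "AE \<omega> in M. norm ((norm (X \<omega>))\<^sup>2) \<le> norm (1 + norm (X \<omega>) powr (2 + \<gamma>))"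
  proof (rule AE_I2)
    fix \<omega>
    show "norm ((norm (X \<omega>))\<^sup>2) \<le> norm (1 + norm (X \<omega>) powr (2 + \<gamma>))"
    proof (cases "norm (X \<omega>) \<le> 1")
      case True
      then have "(norm (X \<omega>))\<^sup>2 \<le> 1"
        by (simp add: power_le_one)
      then show ?thesis
        by (simp add: add_increasing2)
    next
      case False
      then have "norm (X \<omega>) powr 2 \<le> norm (X \<omega>) powr (2 + \<gamma>)"
        using assms(3) by (intro powr_mono) auto
      moreover have "norm (X \<omega>) powr 2 = (norm (X \<omega>))\<^sup>2"
        using False by (intro powr_numeral) auto
      ultimately show ?thesis
        by simp
    qed
  qed
qed (use assms(2) in simp)

theorem theorem2p3:
  fixes M :: "'w measure"
    and X :: "nat \<Rightarrow> 'w \<Rightarrow> real ^ 2"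
    and \<gamma> \<delta> :: real
  assumes "prob_space M"
    and "prob_space.indep_vars M (\<lambda>_. borel) X {1..}"
    and "\<And>t. t \<ge> 1 \<Longrightarrow> distr M borel (X t) = distr M borel (X 1)"
    and "\<gamma> > 0"
    and "integrable M (\<lambda>\<omega>. norm (X 1 \<omega>) powr (2 + \<gamma>))"
    and "\<delta> > 0"
  shows "(SUP n\<in>{1..}. \<integral>\<^sup>+ \<omega>.
            weighted_sup_norm (log_weight \<delta>) (\<lambda>u. ecf_process M X n u \<omega>) \<partial>M) < \<infinity>"
proof -
  interpret prob_space M by fact
  define v :: "real ^ 2" where "v = vector [1, 1]"
  define Y where "Y t \<omega> = v \<bullet> X t \<omega>" for t \<omega>
  \<comment> \<open>Adding 1 keeps \<sigma> positive for degenerate Y.\<close>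
  define \<sigma> where "\<sigma> = sqrt (expectation (\<lambda>\<omega>. (Y 1 \<omega>)\<^sup>2)) + 1"
  have X_rv: "random_variable borel (X t)" if "t \<ge> 1" for t
    using assms(2) that unfolding indep_vars_def2 by blast
  have v_meas: "(\<lambda>x. v \<bullet> x) \<in> borel_measurable borel"
    by simp
  have second_moment_nonneg: "0 \<le> expectation (\<lambda>\<omega>. (Y 1 \<omega>)\<^sup>2)"
    by simp
  interpret iid_real M Y \<sigma>
  proof
    show "indep_vars (\<lambda>_. borel) Y {1..}"
      unfolding Y_def by (rule indep_vars_compose2[OF assms(2)]) simp
    show "distr M borel (Y t) = distr M borel (Y 1)" if "t \<ge> 1" for t
    proof -
      have "distr M borel (Y s) = distr (distr M borel (X s)) borel (\<lambda>x. v \<bullet> x)" if "s \<ge> 1" for s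
        using distr_distr[OF v_meas X_rv[OF that]] by (simp add: comp_def Y_def [abs_def])
      then show ?thesis
        using assms(3)[OF that] that by simp
    qed
    have "integrable M (\<lambda>\<omega>. (norm (X 1 \<omega>))\<^sup>2)"
      using X_rv[of 1] assms by (intro integrable_norm_squared_of_powr[of _ _ \<gamma>] finite_measure_axioms) auto
    then have "integrable M (\<lambda>\<omega>. (norm v)\<^sup>2 * (norm (X 1 \<omega>))\<^sup>2)"
      by simp
    then show "integrable M (\<lambda>\<omega>. (Y 1 \<omega>)\<^sup>2)"
    proof (rule Bochner_Integration.integrable_bound)
      show "(\<lambda>\<omega>. (Y 1 \<omega>)\<^sup>2) \<in> borel_measurable M"
        unfolding Y_def using X_rv[of 1] by simp
      show "AE \<omega> in M. norm ((Y 1 \<omega>)\<^sup>2) \<le> norm ((norm v)\<^sup>2 * (norm (X 1 \<omega>))\<^sup>2)"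
        unfolding Y_def by (intro AE_I2) (simp add: Cauchy_Schwarz_ineq power2_norm_eq_inner)
    qed
    have "(sqrt (expectation (\<lambda>\<omega>. (Y 1 \<omega>)\<^sup>2)))\<^sup>2 \<le> \<sigma>\<^sup>2"
      unfolding \<sigma>_def by (intro power_mono) auto
    then show "expectation (\<lambda>\<omega>. (Y 1 \<omega>)\<^sup>2) \<le> \<sigma>\<^sup>2"
      using second_moment_nonneg by simp
    show "\<sigma> > 0"
      unfolding \<sigma>_def using second_moment_nonneg by (intro add_nonneg_pos) auto
  qed
  define a where "a j = (2 ^ j / 4) powr (- 1 / 2 - \<delta>)" for j :: nat
  \<comment> \<open>Product of the chaining constant and the factor from
    \<open>powr_times_sqrt_dyadic\<close>; it does not depend on n.\<close>
  define K where "K = (170 + 204 * \<sigma>) * 4 powr (1 / 2 + \<delta>)"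
  have K: "K \<ge> 0"
    using \<sigma>_pos by (simp add: K_def)

  have ecf: "ecf_process M X n (vector [U, U]) \<omega> = real_ecf_process M Y n \<omega> U" for n U \<omega>
  proof -
    have "vector [U, U] = U *\<^sub>R v"
      by (simp add: v_def vec_eq_iff forall_2)
    then show ?thesis
      by (simp add: ecf_process_def real_ecf_process_def Y_def)
  qed
  \<comment> \<open>This replaces the uncountable supremum, pointwise in \<omega>, by a series of
    measurable terms that can be integrated one by one.\<close>
  have sup_le: "weighted_sup_norm (log_weight \<delta>) (\<lambda>u. ecf_process M X n u \<omega>)
      \<le> (\<Sum>j. ennreal (a j) * dyadic_majorant (2 ^ j) (real_ecf_process M Y n \<omega>))" for n \<omega>
    unfolding weighted_sup_norm_def diagonal_def a_def
    using weighted_norm_le_suminf_dyadic[OF assms(6) continuous_real_ecf_process]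
    by (auto simp: ecf intro!: SUP_least)
  have "(\<integral>\<^sup>+\<omega>. weighted_sup_norm (log_weight \<delta>) (\<lambda>u. ecf_process M X n u \<omega>) \<partial>M)
      \<le> (\<Sum>j. ennreal (K * (2 powr (- \<delta>)) ^ j))" if "n \<ge> 1" for n
  proof -
    have "(\<integral>\<^sup>+\<omega>. weighted_sup_norm (log_weight \<delta>) (\<lambda>u. ecf_process M X n u \<omega>) \<partial>M)
        \<le> (\<integral>\<^sup>+\<omega>. (\<Sum>j. ennreal (a j) * dyadic_majorant (2 ^ j) (real_ecf_process M Y n \<omega>)) \<partial>M)"
      by (intro nn_integral_mono sup_le)
    also have "\<dots> = (\<Sum>j. ennreal (a j) * (\<integral>\<^sup>+\<omega>. dyadic_majorant (2 ^ j) (real_ecf_process M Y n \<omega>) \<partial>M))"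
      using dyadic_majorant_measurable by (simp add: nn_integral_suminf nn_integral_cmult)
    also have "\<dots> \<le> (\<Sum>j. ennreal (a j) * ennreal ((170 + 204 * \<sigma>) * sqrt (2 ^ j)))"
      using nn_integral_dyadic_majorant_le[OF that, of "2 ^ j" for j]
      by (intro suminf_le mult_left_mono) auto
    also have "\<dots> = (\<Sum>j. ennreal (K * (2 powr (- \<delta>)) ^ j))"
    proof (rule suminf_cong)
      fix j
      have "a j * ((170 + 204 * \<sigma>) * sqrt (2 ^ j)) = K * (2 powr (- \<delta>)) ^ j"
        using powr_times_sqrt_dyadic[of j \<delta>] by (simp add: a_def K_def mult_ac)
      then show "ennreal (a j) * ennreal ((170 + 204 * \<sigma>) * sqrt (2 ^ j)) = ennreal (K * (2 powr (- \<delta>)) ^ j)"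
        using \<sigma>_pos by (subst ennreal_mult [symmetric]) (auto simp: a_def)
    qed
    finally show ?thesis .
  qed
  then have "(SUP n\<in>{1..}. \<integral>\<^sup>+ \<omega>. weighted_sup_norm (log_weight \<delta>) (\<lambda>u. ecf_process M X n u \<omega>) \<partial>M)
      \<le> (\<Sum>j. ennreal (K * (2 powr (- \<delta>)) ^ j))"
    by (auto intro: SUP_least)
  also have "\<dots> = ennreal (\<Sum>j. K * (2 powr (- \<delta>)) ^ j)"
  proof (rule suminf_ennreal2)
    have "2 powr (- \<delta>) < 1"
      using assms(6) by (simp add: powr_less_one)
    then show "summable (\<lambda>j. K * (2 powr (- \<delta>)) ^ j)"
      by (intro summable_mult summable_geometric) simp
  qed (use K in simp)
  also have "\<dots> < \<infinity>"
    by simp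
  finally show ?thesis .
qed

end
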